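(* $$A^*=PAP^{-1},\qquad A^{\varepsilon}=PA^*P^{-1},\qquad A=PA^{\varepsilon}P^{-1}.$$
   Context: Let $D$ be a positive integer and let $Q_D$ be the $D$-cube: the graph with vertex set $X=\{0,1\}^D$, two vertices being adjacent iff they differ in exactly one coordinate; $\partial$ denotes path-length distance. $\mathrm{Mat}_X(\mathbb{C})$ is the algebra of complex matrices with rows and columns indexed by $X$. Write $\mathbf{i}^2=-1$. Let $A$ be the adjacency matrix of $Q_D$. Fix $x=(0,0,\ldots,0)\in X$. Let $A^*$ be the diagonal matrix in $\mathrm{Mat}_X(\mathbb{C})$ with $(y,y)$-entry $D-2\partial(x,y)$ for $y\in X$ (the dual adjacency matrix). Let $A^{\varepsilon}=-\mathbf{i}(AA^*-A^*A)/2$ (the imaginary adjacency matrix). Let $P_1$ be the matrix with rows and columns indexed by $\{0,1\}$, with $(0,0)$-entry $1$, $(0,1)$-entry $1$, $(1,0)$-entry $-\mathbf{i}$, and $(1,1)$-entry $\mathbf{i}$. Let $P=P_1^{\otimes D}\in\mathrm{Mat}_X(\mathbb{C})$ be the $D$-fold Kronecker power, i.e. for $y=(y_1,\ldots,y_D)$ and $z=(z_1,\ldots,z_D)$ in $X$, $P_{yz}=\prod_{k=1}^D (P_1)_{y_kz_k}$. The matrix $P$ is invertible. *)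

theory Defs
  imports "HOL-Analysis.Analysis"
begin

text \<open>
  The vertex set \<open>{0,1}\<^sup>D\<close> of the \<open>D\<close>-cube is the type \<^typ>\<open>2 ^ 'n\<close> with \<open>D = CARD('n)\<close>, which is
  positive because types are inhabited. The two elements of \<^typ>\<open>2\<close> are \<open>0\<close> and \<open>1\<close>; its arithmetic
  (modulo 2) is not used. In a matrix \<open>M :: complex ^ 'c ^ 'r\<close> the \<open>(y, z)\<close>-entry is \<open>M $ y $ z\<close>.
\<close>

type_synonym 'n vertex = "2 ^ 'n"

type_synonym 'n cube_mat = "complex ^ 'n vertex ^ 'n vertex"

definition cube_adj :: "'n::finite vertex \<Rightarrow> 'n vertex \<Rightarrow> bool" where
  "cube_adj y z \<longleftrightarrow> (\<exists>!i. y $ i \<noteq> z $ i)"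

text \<open>
  \<open>(cube_adj ^^ n) y z\<close> says that there is a walk of length \<open>n\<close> from \<open>y\<close> to \<open>z\<close>; a shortest walk is a
  shortest path. The cube is connected, so the minimum is over a nonempty set.
\<close>

definition cube_dist :: "'n::finite vertex \<Rightarrow> 'n vertex \<Rightarrow> nat" where
  "cube_dist y z = (LEAST n. (cube_adj ^^ n) y z)"

definition adj_mat :: "'n::finite cube_mat" where
  "adj_mat = (\<chi> y z. if cube_adj y z then 1 else 0)"

definition dual_adj_mat :: "'n::finite vertex \<Rightarrow> 'n cube_mat" where
  "dual_adj_mat x =
    (\<chi> y z. if y = z then of_nat CARD('n) - 2 * of_nat (cube_dist x y) else 0)"

definition imag_adj_mat :: "'n::finite vertex \<Rightarrow> 'n cube_mat" where
  "imag_adj_mat x =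
    (\<chi> y z. - \<i> * (adj_mat ** dual_adj_mat x - dual_adj_mat x ** adj_mat) $ y $ z / 2)"

definition P1 :: "complex ^ 2 ^ 2" where
  "P1 = (\<chi> a b. if a = 0 then 1 else if b = 0 then - \<i> else \<i>)"

definition kronecker_power :: "complex ^ 2 ^ 2 \<Rightarrow> 'n::finite cube_mat" where
  "kronecker_power M = (\<chi> y z. \<Prod>k\<in>UNIV. M $ (y $ k) $ (z $ k))"

definition P :: "'n::finite cube_mat" where
  "P = kronecker_power P1"

lemma kronecker_power_mult:
  "(kronecker_power M ** kronecker_power N :: 'n::finite cube_mat) = kronecker_power (M ** N)"
proof -
  have "(\<Sum>w\<in>UNIV. (\<Prod>k\<in>UNIV. M $ (y $ k) $ (w $ k)) * (\<Prod>k\<in>UNIV. N $ (w $ k) $ (z $ k)))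
      = (\<Prod>k\<in>UNIV. \<Sum>c\<in>UNIV. M $ (y $ k) $ c * N $ c $ (z $ k))" (is "?L = ?R")
    for y z :: "'n vertex"
  proof -
    have "?R = (\<Sum>g\<in>PiE UNIV (\<lambda>_. UNIV). \<Prod>k\<in>UNIV. M $ (y $ k) $ g k * N $ g k $ (z $ k))"
      by (rule prod_sum_PiE) auto
    also have "\<dots> = (\<Sum>g\<in>UNIV. \<Prod>k\<in>UNIV. M $ (y $ k) $ g k * N $ g k $ (z $ k))"
      by (simp add: PiE_UNIV_domain)
    also have "\<dots> = (\<Sum>w\<in>UNIV. \<Prod>k\<in>UNIV. M $ (y $ k) $ (w $ k) * N $ (w $ k) $ (z $ k))"
      by (rule sum.reindex_bij_witness[of _ vec_nth vec_lambda]) auto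
    finally show ?thesis
      by (simp add: prod.distrib)
  qed
  then show ?thesis
    by (simp add: kronecker_power_def matrix_matrix_mult_def vec_eq_iff)
qed

lemma kronecker_power_one: "(kronecker_power (mat 1) :: 'n::finite cube_mat) = mat 1"
  by (auto simp: kronecker_power_def mat_def vec_eq_iff)

lemma invertible_P: "invertible (P :: 'n::finite cube_mat)"
proof -
  define Q :: "complex ^ 2 ^ 2" where "Q = (\<chi> a b. if b = 0 then 1 / 2 else if a = 0 then \<i> / 2 else - \<i> / 2)"
  have "P1 ** Q = mat 1"
    by (auto simp: P1_def Q_def matrix_matrix_mult_def mat_def vec_eq_iff forall_2 UNIV_2)
  moreover have "Q ** P1 = mat 1"
    by (auto simp: P1_def Q_def matrix_matrix_mult_def mat_def vec_eq_iff forall_2 UNIV_2)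
  ultimately show ?thesis
    unfolding invertible_def P_def
    by (intro exI[of _ "kronecker_power Q"]) (simp add: kronecker_power_mult kronecker_power_one)
qed

end

theory Submission
  imports Defs
begin

text \<open>
  Each of the three matrices is a sum over the coordinates \<open>k\<close> of a Kronecker product with a single
  \<open>2 \<times> 2\<close> matrix in position \<open>k\<close> and identity matrices elsewhere, the same \<open>2 \<times> 2\<close> matrix for every
  \<open>k\<close>. Conjugation by \<open>P\<close> acts on such a sum through conjugation of the \<open>2 \<times> 2\<close> matrix by \<open>P1\<close>, so
  the claims reduce to the case \<open>D = 1\<close>.
\<close>

section \<open>Kronecker products and Kronecker sums\<close>

definition kronecker_prod :: "('n \<Rightarrow> complex ^ 2 ^ 2) \<Rightarrow> 'n::finite cube_mat" where
  "kronecker_prod F = (\<chi> y z. \<Prod>k\<in>UNIV. F k $ (y $ k) $ (z $ k))"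

lemma kronecker_power_eq_prod: "kronecker_power M = kronecker_prod (\<lambda>_. M)"
  by (simp add: kronecker_power_def kronecker_prod_def)

text \<open>Mixed-product rule: by distributivity the product of sums has one term for each function
  from coordinates to \<open>{0,1}\<close>, and these functions are the vertices
  \<open>w\<close>.\<close>

lemma kronecker_prod_mult:
  "kronecker_prod F ** kronecker_prod G = kronecker_prod (\<lambda>k. F k ** G k)"
proof -
  have "(\<Sum>w\<in>UNIV. (\<Prod>k\<in>UNIV. F k $ (y $ k) $ (w $ k)) * (\<Prod>k\<in>UNIV. G k $ (w $ k) $ (z $ k)))
      = (\<Prod>k\<in>UNIV. \<Sum>c\<in>UNIV. F k $ (y $ k) $ c * G k $ c $ (z $ k))" (is "?L = ?R")
    for y z :: "'a vertex"
  proof -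
    have "?R = (\<Sum>g\<in>PiE UNIV (\<lambda>_. UNIV). \<Prod>k\<in>UNIV. F k $ (y $ k) $ g k * G k $ g k $ (z $ k))"
      by (rule prod_sum_PiE) auto
    also have "\<dots> = (\<Sum>w\<in>UNIV. \<Prod>k\<in>UNIV. F k $ (y $ k) $ (w $ k) * G k $ (w $ k) $ (z $ k))"
      by (rule sum.reindex_bij_witness[of _ vec_nth vec_lambda]) auto
    finally show ?thesis
      by (simp add: prod.distrib)
  qed
  then show ?thesis
    by (simp add: kronecker_prod_def matrix_matrix_mult_def vec_eq_iff)
qed

definition kronecker_sum :: "complex ^ 2 ^ 2 \<Rightarrow> 'n::finite cube_mat" where
  "kronecker_sum M = (\<Sum>k\<in>UNIV. kronecker_prod ((\<lambda>_. mat 1)(k := M)))"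

text \<open>An identity factor at \<open>j\<close> contributes 1 or 0 according to whether
  \<open>y\<close> and \<open>z\<close> agree there, so the summand for \<open>k\<close> survives
  only if they agree off \<open>k\<close>.\<close>

lemma kronecker_sum_nth:
  "kronecker_sum M $ y $ z =
    (\<Sum>k\<in>UNIV. if \<forall>j. j \<noteq> k \<longrightarrow> y $ j = z $ j then M $ (y $ k) $ (z $ k) else 0)"
proof -
  have "kronecker_prod ((\<lambda>_. mat 1)(k := M)) $ y $ z =
      (if \<forall>j. j \<noteq> k \<longrightarrow> y $ j = z $ j then M $ (y $ k) $ (z $ k) else 0)" for k
  proof -
    have "(\<Prod>j\<in>UNIV. ((\<lambda>_. mat 1)(k := M)) j $ (y $ j) $ (z $ j)) =
        M $ (y $ k) $ (z $ k) * (\<Prod>j\<in>UNIV - {k}. ((\<lambda>_. mat 1)(k := M)) j $ (y $ j) $ (z $ j))"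
      by (subst prod.remove[of _ k]) auto
    also have "(\<Prod>j\<in>UNIV - {k}. ((\<lambda>_. mat 1)(k := M)) j $ (y $ j) $ (z $ j)) =
        (if \<forall>j. j \<noteq> k \<longrightarrow> y $ j = z $ j then 1 else 0)"
      by (auto simp: mat_def)
    finally show ?thesis
      unfolding kronecker_prod_def by (auto simp del: fun_upd_apply)
  qed
  then show ?thesis
    by (simp add: kronecker_sum_def)
qed

lemma matrix_mult_sum_left: "(\<Sum>k\<in>S. f k) ** (B :: 'a::semiring_1 ^ 'c ^ 'b) = (\<Sum>k\<in>S. f k ** B)"
  by (simp add: matrix_matrix_mult_def vec_eq_iff sum_distrib_right) (intro allI sum.swap)

lemma matrix_mult_sum_right: "(B :: 'a::semiring_1 ^ 'c ^ 'b) ** (\<Sum>k\<in>S. f k) = (\<Sum>k\<in>S. B ** f k)"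
  by (simp add: matrix_matrix_mult_def vec_eq_iff sum_distrib_left) (intro allI sum.swap)

lemma matrix_inv_right:
  fixes A :: "'a::semiring_1 ^ 'n ^ 'm"
  assumes "invertible A"
  shows "A ** matrix_inv A = mat 1"
  using someI_ex[OF assms[unfolded invertible_def]] by (simp add: matrix_inv_def)

text \<open>Holds summand by summand: at position \<open>k\<close> it is the hypothesis, elsewhere
  the identity commutes with \<open>Q\<close>. Being free of inverses, the hypothesis is checked by
  multiplication alone.\<close>

lemma kronecker_sum_intertwine:
  assumes "M ** Q = Q ** N"
  shows "(kronecker_sum M :: 'n::finite cube_mat) ** kronecker_power Q
    = kronecker_power Q ** kronecker_sum N"
proof -
  have "(\<lambda>j. ((\<lambda>_. mat 1)(k := M)) j ** Q) = (\<lambda>j. Q ** ((\<lambda>_. mat 1)(k := N)) j)" for k :: 'n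
    using assms by auto
  then show ?thesis
    unfolding kronecker_sum_def kronecker_power_eq_prod matrix_mult_sum_left
      matrix_mult_sum_right kronecker_prod_mult by simp
qed

lemma kronecker_sum_conj_P:
  assumes "M ** P1 = P1 ** N"
  shows "(kronecker_sum M :: 'n::finite cube_mat) = P ** kronecker_sum N ** matrix_inv P"
proof -
  have "(kronecker_sum M :: 'n cube_mat) = kronecker_sum M ** P ** matrix_inv P"
    by (simp flip: matrix_mul_assoc add: matrix_inv_right invertible_P)
  then show ?thesis
    unfolding P_def by (simp add: kronecker_sum_intertwine[OF assms])
qed

section \<open>Path-length distance equals Hamming distance\<close>

lemma hamming_triangle:
  fixes u v w :: "'a ^ 'n::finite"
  shows "card {i. u $ i \<noteq> w $ i} \<le> card {i. u $ i \<noteq> v $ i} + card {i. v $ i \<noteq> w $ i}"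
  by (rule order_trans[OF card_mono card_Un_le]) auto

lemma cube_adj_iff_hamming: "cube_adj y z \<longleftrightarrow> card {i. y $ i \<noteq> z $ i} = 1"
  unfolding cube_adj_def
  by (auto simp: card_1_singleton_iff set_eq_iff)

text \<open>Each step of a walk changes one coordinate, so it raises the Hamming distance from
  \<open>y\<close> by at most 1.\<close>

lemma hamming_le_walk_length:
  "(cube_adj ^^ n) y z \<Longrightarrow> card {i. y $ i \<noteq> z $ i} \<le> n"
proof (induction n arbitrary: z)
  case (Suc n)
  then obtain w where "(cube_adj ^^ n) y w" "cube_adj w z"
    by auto
  then show ?case
    using Suc.IH[of w] hamming_triangle[of y z w] cube_adj_iff_hamming[of w z] by simp
qed auto

lemma ex_walk_hamming: "card {i. y $ i \<noteq> z $ i} = n \<Longrightarrow> (cube_adj ^^ n) y z"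
proof (induction n arbitrary: z)
  case 0
  then show ?case by (simp add: vec_eq_iff)
next
  case (Suc n)
  then obtain k where k: "y $ k \<noteq> z $ k"
    by (metis (mono_tags, lifting) Collect_empty_eq card.empty nat.distinct(1))
  \<comment> \<open>The last vertex before \<open>z\<close>: resetting coordinate \<open>k\<close>
    of \<open>z\<close> to its value in \<open>y\<close> brings it one closer to
    \<open>y\<close>.\<close>
  define w where "w = (\<chi> i. if i = k then y $ k else z $ i)"
  have "{i. y $ i \<noteq> w $ i} = {i. y $ i \<noteq> z $ i} - {k}"
    by (auto simp: w_def)
  then have "(cube_adj ^^ n) y w"
    using Suc k by (intro Suc.IH) simp
  moreover have "cube_adj w z"
    unfolding cube_adj_def using k by (intro ex1I[of _ k]) (auto simp: w_def split: if_splits)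
  ultimately show ?case
    by auto
qed

lemma cube_dist_eq_hamming: "cube_dist y z = card {i. y $ i \<noteq> z $ i}"
  unfolding cube_dist_def
  by (intro Least_equality) (auto simp: ex_walk_hamming hamming_le_walk_length)

section \<open>The case \<open>D = 1\<close>, and the three matrices as Kronecker sums\<close>

definition A1 :: "complex ^ 2 ^ 2" where
  "A1 = (\<chi> a b. if a = b then 0 else 1)"

definition dual_A1 :: "complex ^ 2 ^ 2" where
  "dual_A1 = (\<chi> a b. if a = b then if a = 0 then 1 else - 1 else 0)"

text \<open>The value of \<open>- \<i> * (A1 ** dual_A1 - dual_A1 ** A1) / 2\<close>, written
  out.\<close>

definition imag_A1 :: "complex ^ 2 ^ 2" where
  "imag_A1 = (\<chi> a b. if a = b then 0 else if a = 0 then \<i> else - \<i>)"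

text \<open>The theorem for \<open>D = 1\<close>: conjugation by \<open>P1\<close> permutes the
  three matrices cyclically.\<close>

lemma dual_A1_P1: "dual_A1 ** P1 = P1 ** A1"
  and imag_A1_P1: "imag_A1 ** P1 = P1 ** dual_A1"
  and A1_P1: "A1 ** P1 = P1 ** imag_A1"
  by (auto simp: P1_def A1_def dual_A1_def imag_A1_def matrix_matrix_mult_def vec_eq_iff
      forall_2 UNIV_2)

lemma adj_mat_eq_kronecker_sum: "(adj_mat :: 'n::finite cube_mat) = kronecker_sum A1"
proof -
  have "kronecker_sum A1 $ y $ z = (if cube_adj y z then 1 else 0)" for y z :: "'n vertex"
  proof (cases "cube_adj y z")
    case True
    then obtain k where k: "y $ k \<noteq> z $ k" "\<And>i. y $ i \<noteq> z $ i \<Longrightarrow> i = k"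
      unfolding cube_adj_def by blast
    have "(\<forall>j. j \<noteq> i \<longrightarrow> y $ j = z $ j) \<longleftrightarrow> i = k" for i
      using k by metis
    then have "kronecker_sum A1 $ y $ z = A1 $ (y $ k) $ (z $ k)"
      by (simp add: kronecker_sum_nth)
    then show ?thesis
      using True k(1) by (simp add: A1_def)
  next
    case False
    \<comment> \<open>A difference at \<open>k\<close> would be the only one and make the vertices
      adjacent; so only the zero diagonal of \<open>A1\<close> is met.\<close>
    then have "y $ k = z $ k" if "\<forall>j. j \<noteq> k \<longrightarrow> y $ j = z $ j" for k
      using that unfolding cube_adj_def by metis
    then have "kronecker_sum A1 $ y $ z = 0"
      unfolding kronecker_sum_nth by (intro sum.neutral) (simp add: A1_def)
    then show ?thesis
      using False by simp
  qed
  then show ?thesis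
    by (simp add: adj_mat_def vec_eq_iff)
qed

lemma dual_adj_mat_0_eq_kronecker_sum: "(dual_adj_mat 0 :: 'n::finite cube_mat) = kronecker_sum dual_A1"
proof -
  have diag: "of_nat CARD('n) - 2 * of_nat (cube_dist 0 y) = kronecker_sum dual_A1 $ y $ y"
    for y :: "'n vertex"
  proof -
    \<comment> \<open>The diagonal entries 1 and -1 of \<open>dual_A1\<close> are 1 minus twice the
      indicator of a nonzero coordinate.\<close>
    have "kronecker_sum dual_A1 $ y $ y = (\<Sum>k\<in>UNIV. 1 - 2 * (if y $ k \<noteq> 0 then 1 else 0))"
      unfolding kronecker_sum_nth by (intro sum.cong) (auto simp: dual_A1_def)
    also have "\<dots> = of_nat CARD('n) - 2 * of_nat (card {k. y $ k \<noteq> 0})"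
      by (simp add: sum_subtractf sum.If_cases flip: sum_distrib_left)
    finally show ?thesis
      by (simp add: cube_dist_eq_hamming)
  qed
  have off: "kronecker_sum dual_A1 $ y $ z = 0" if "y \<noteq> z" for y z :: "'n vertex"
  proof -
    have "y $ k \<noteq> z $ k" if "\<forall>j. j \<noteq> k \<longrightarrow> y $ j = z $ j" for k
      using that \<open>y \<noteq> z\<close> by (metis vec_eq_iff)
    then show ?thesis
      unfolding kronecker_sum_nth by (intro sum.neutral) (simp add: dual_A1_def)
  qed
  show ?thesis
    by (intro vec_eq_iff[THEN iffD2] allI) (simp add: dual_adj_mat_def diag off)
qed

text \<open>Multiplying by a diagonal matrix scales columns or rows, so the commutator scales each
  entry by a difference of diagonal entries.\<close>

lemma imag_adj_mat_nth:
  "imag_adj_mat x $ y $ z =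
    - \<i> * (adj_mat $ y $ z * (dual_adj_mat x $ z $ z - dual_adj_mat x $ y $ y) / 2)"
proof -
  have "(adj_mat ** dual_adj_mat x) $ y $ z = adj_mat $ y $ z * dual_adj_mat x $ z $ z"
    by (simp add: matrix_matrix_mult_def dual_adj_mat_def if_distrib cong: if_cong)
  moreover have "(dual_adj_mat x ** adj_mat) $ y $ z = dual_adj_mat x $ y $ y * adj_mat $ y $ z"
    by (simp add: matrix_matrix_mult_def dual_adj_mat_def if_distrib[of "\<lambda>a. a * _"] cong: if_cong)
  ultimately show ?thesis
    by (simp add: imag_adj_mat_def algebra_simps)
qed

text \<open>The commutator of two Kronecker sums is the Kronecker sum of the commutators, since
  factors in different positions commute. Here this is verified entrywise.\<close>

lemma imag_adj_mat_0_eq_kronecker_sum: "(imag_adj_mat 0 :: 'n::finite cube_mat) = kronecker_sum imag_A1"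
proof -
  have "imag_adj_mat 0 $ y $ z = kronecker_sum imag_A1 $ y $ z" for y z :: "'n vertex"
  proof -
    let ?c = "\<lambda>k. \<forall>j. j \<noteq> k \<longrightarrow> y $ j = z $ j"
    let ?s = "\<lambda>k. dual_A1 $ (z $ k) $ (z $ k) - dual_A1 $ (y $ k) $ (y $ k)"
    define S where "S = (\<Sum>l\<in>UNIV. ?s l)"
    have "dual_adj_mat 0 $ z $ z - dual_adj_mat 0 $ y $ y = S"
      by (simp add: S_def dual_adj_mat_0_eq_kronecker_sum kronecker_sum_nth sum_subtractf)
    then have "imag_adj_mat 0 $ y $ z =
        - \<i> * ((\<Sum>k\<in>UNIV. if ?c k then A1 $ (y $ k) $ (z $ k) else 0) * S / 2)"
      by (simp only: imag_adj_mat_nth adj_mat_eq_kronecker_sum kronecker_sum_nth)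
    also have "\<dots> = (\<Sum>k\<in>UNIV. - \<i> * ((if ?c k then A1 $ (y $ k) $ (z $ k) else 0) * S / 2))"
      by (simp only: sum_distrib_left sum_distrib_right sum_divide_distrib)
    also have "\<dots> = (\<Sum>k\<in>UNIV. if ?c k then imag_A1 $ (y $ k) $ (z $ k) else 0)"
    proof (intro sum.cong refl)
      fix k
      define c where "c \<longleftrightarrow> ?c k"
      \<comment> \<open>Where \<open>y\<close> and \<open>z\<close> agree, the two diagonal values
        cancel, leaving only position \<open>k\<close>.\<close>
      have "S = ?s k" if c
      proof -
        have "(\<Sum>l\<in>UNIV - {k}. ?s l) = 0"
          using that unfolding c_def by (intro sum.neutral) auto
        then show ?thesis
          unfolding S_def by (simp add: sum.remove[of UNIV k])
      qed
      \<comment> \<open>The entry formula of \<open>imag_adj_mat_nth\<close> in the case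
        \<open>D = 1\<close>.\<close>
      moreover have "- \<i> * (A1 $ a $ b * (dual_A1 $ b $ b - dual_A1 $ a $ a) / 2) = imag_A1 $ a $ b"
        for a b
        using exhaust_2[of a] exhaust_2[of b] by (auto simp: A1_def dual_A1_def imag_A1_def)
      ultimately show "- \<i> * ((if ?c k then A1 $ (y $ k) $ (z $ k) else 0) * S / 2) =
          (if ?c k then imag_A1 $ (y $ k) $ (z $ k) else 0)"
        unfolding c_def[symmetric]
        by (cases c) (simp_all only: if_True if_False simp_thms mult_zero_left mult_zero_right div_0)
    qed
    finally show ?thesis
      by (simp add: kronecker_sum_nth)
  qed
  then show ?thesis
    by (simp add: vec_eq_iff)
qed

theorem theorem7p4:
  fixes x :: "'n::finite vertex"
  assumes "x = 0"
  shows "dual_adj_mat x = P ** adj_mat ** matrix_inv P \<and>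
    imag_adj_mat x = P ** dual_adj_mat x ** matrix_inv P \<and>
    adj_mat = P ** imag_adj_mat x ** matrix_inv P"
  unfolding assms adj_mat_eq_kronecker_sum dual_adj_mat_0_eq_kronecker_sum
    imag_adj_mat_0_eq_kronecker_sum
  by (intro conjI kronecker_sum_conj_P dual_A1_P1 imag_A1_P1 A1_P1)

end
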